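(* For every $n\in\mathbb{N}$, $$\sum_{k=0}^{2n}(-1)^kW_{k+1}\star W_{k-2n}=(-1)^n[2]_q^{2n}\big(q^{-2}x(yyxx)^ny+y(xxyy)^nx\big),$$ $$\sum_{k=0}^{2n}(-1)^kW_{k-2n}\star W_{k+1}=(-1)^n[2]_q^{2n}\big(x(yyxx)^ny+q^{-2}y(xxyy)^nx\big),$$ $$\sum_{k=0}^{2n+1}(-1)^kW_{k+1}\star W_{k-2n-1}=(-1)^nq^{-1}[2]_q^{2n+1}\big(xyy(xxyy)^nx-yxx(yyxx)^ny\big),$$ $$\sum_{k=0}^{2n+1}(-1)^kW_{k-2n-1}\star W_{k+1}=(-1)^nq^{-1}[2]_q^{2n+1}\big(xyy(xxyy)^nx-yxx(yyxx)^ny\big).$$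
   Context: Let $\mathbb{F}$ be a field of characteristic zero and let $q\in\mathbb{F}$ be nonzero and not a root of unity; $\mathbb{N}=\{0,1,2,\ldots\}$; $[2]_q=q+q^{-1}$. Let $\mathbb{V}$ be the free associative unital $\mathbb{F}$-algebra on two noncommuting generators (letters) $x,y$; the words in $x,y$ (including the trivial word $\mathbf{1}$) form a basis of $\mathbb{V}$. Words such as $(xxyy)^nx$ are written with respect to the free (concatenation) product. The $q$-shuffle product $\star$ on the vector space $\mathbb{V}$ is the bilinear associative product with unit $\mathbf{1}$ determined as follows. Put $\langle x,x\rangle=\langle y,y\rangle=2$ and $\langle x,y\rangle=\langle y,x\rangle=-2$. For nontrivial words $u=u_1\cdots u_r$ and $v=v_1\cdots v_s$, $$u\star v=u_1\big((u_2\cdots u_r)\star v\big)+v_1\big(u\star(v_2\cdots v_s)\big)q^{\langle v_1,u_1\rangle+\cdots+\langle v_1,u_r\rangle}.$$ The alternating words $W_m$ ($m\in\mathbb{Z}$) are, for $n\in\mathbb{N}$ (powers in the free product): $W_{-n}=(xy)^nx$, $W_{n+1}=(yx)^ny$. *)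

theory Defs
  imports Main "HOL-Library.Poly_Mapping"
begin

datatype letter = LX | LY

type_synonym word = "letter list"

(* Lists under concatenation form the free monoid.  With this instance, the ring structure
   that Poly_Mapping puts on word \<Rightarrow>\<^sub>0 'a is the free associative unital algebra:
   * and ^ are the free (concatenation) product and its powers, 1 is the trivial word. *)

instantiation list :: (type) monoid_add
begin

definition zero_list :: "'a list" where "zero_list = []"

definition plus_list :: "'a list \<Rightarrow> 'a list \<Rightarrow> 'a list" where "plus_list = (@)"

instance by standard (simp_all add: zero_list_def plus_list_def)

end

type_synonym 'a freealg = "word \<Rightarrow>\<^sub>0 'a"

definition of_word :: "word \<Rightarrow> 'a::field freealg" where
  "of_word w = Poly_Mapping.single w 1"

abbreviation letter_x :: "'a::field freealg" ("\<^bold>x") where "\<^bold>x \<equiv> of_word [LX]"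
abbreviation letter_y :: "'a::field freealg" ("\<^bold>y") where "\<^bold>y \<equiv> of_word [LY]"

definition scal :: "'a::field \<Rightarrow> 'a freealg \<Rightarrow> 'a freealg" (infixr "\<odot>" 75) where
  "c \<odot> f = Poly_Mapping.map ((*) c) f"

definition pairing :: "letter \<Rightarrow> letter \<Rightarrow> int" where
  "pairing a b = (if a = b then 2 else - 2)"

fun word_qshuffle :: "'a::field \<Rightarrow> word \<Rightarrow> word \<Rightarrow> 'a freealg" where
  "word_qshuffle q [] v = of_word v"
| "word_qshuffle q u [] = of_word u"
| "word_qshuffle q (a # u) (b # v) =
     of_word [a] * word_qshuffle q u (b # v)
     + q powi (\<Sum>c\<leftarrow>a # u. pairing b c) \<odot> (of_word [b] * word_qshuffle q (a # u) v)"

(* bilinear extension from the basis of words *)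
definition qshuffle :: "'a::field freealg \<Rightarrow> 'a \<Rightarrow> 'a freealg \<Rightarrow> 'a freealg"
    ("(_ \<star>\<^bsub>_\<^esub> _)" [71, 0, 71] 70) where
  "f \<star>\<^bsub>q\<^esub> g =
     (\<Sum>u\<in>Poly_Mapping.keys f. \<Sum>v\<in>Poly_Mapping.keys g.
        (Poly_Mapping.lookup f u * Poly_Mapping.lookup g v) \<odot> word_qshuffle q u v)"

(* W (- n) = (xy)^n x and W (n + 1) = (yx)^n y for n \<ge> 0, see alt_word_nonpos, alt_word_pos *)
definition alt_word :: "int \<Rightarrow> 'a::field freealg" where
  "alt_word m = (if m \<le> 0 then (\<^bold>x * \<^bold>y) ^ nat (- m) * \<^bold>x
                 else (\<^bold>y * \<^bold>x) ^ nat (m - 1) * \<^bold>y)"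

definition qtwo :: "'a::field \<Rightarrow> 'a" where
  "qtwo q = q + q powi (-1)"

lemma alt_word_nonpos: "alt_word (- int n) = (\<^bold>x * \<^bold>y) ^ n * \<^bold>x"
  by (simp add: alt_word_def)

lemma alt_word_pos: "alt_word (int n + 1) = (\<^bold>y * \<^bold>x) ^ n * \<^bold>y"
  by (simp add: alt_word_def)

lemma of_word_Nil: "of_word [] = 1"
  by (simp add: of_word_def flip: zero_list_def)

lemma of_word_append: "of_word (u @ v) = of_word u * of_word v"
  by (simp add: of_word_def mult_single plus_list_def)

lemma lookup_scal [simp]: "Poly_Mapping.lookup (c \<odot> f) w = c * Poly_Mapping.lookup f w"
  by (simp add: scal_def Poly_Mapping.map.rep_eq when_def)

lemma scal_0_left [simp]: "0 \<odot> f = 0"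
  by (rule poly_mapping_eqI) simp

lemma scal_0_right [simp]: "c \<odot> 0 = 0"
  by (rule poly_mapping_eqI) simp

lemma scal_1_left [simp]: "1 \<odot> f = f"
  by (rule poly_mapping_eqI) simp

lemma scal_add_left: "(c + d) \<odot> f = c \<odot> f + d \<odot> f"
  by (rule poly_mapping_eqI) (simp add: lookup_add distrib_right)

lemma scal_add_right: "c \<odot> (f + g) = c \<odot> f + c \<odot> g"
  by (rule poly_mapping_eqI) (simp add: lookup_add distrib_left)

lemma scal_scal: "c \<odot> d \<odot> f = (c * d) \<odot> f"
  by (rule poly_mapping_eqI) (simp add: mult.assoc)

lemma scal_sum: "c \<odot> (\<Sum>i\<in>A. f i) = (\<Sum>i\<in>A. c \<odot> f i)"
  by (induction A rule: infinite_finite_induct)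
    (simp_all add: scal_add_right)

lemma qshuffle_of_word: "of_word u \<star>\<^bsub>q\<^esub> of_word v = word_qshuffle q u v"
  by (simp add: qshuffle_def of_word_def)

lemma word_qshuffle_Nil_right: "word_qshuffle q u [] = of_word u"
  by (cases u) simp_all

lemma of_word_expand: "f = (\<Sum>u\<in>Poly_Mapping.keys f. Poly_Mapping.lookup f u \<odot> of_word u)"
  by (rule poly_mapping_eqI)
    (simp add: lookup_sum of_word_def lookup_single when_def sum.delta' if_distrib in_keys_iff
      cong: if_cong)

lemma qshuffle_superset:
  assumes "finite A" "Poly_Mapping.keys f \<subseteq> A" "finite B" "Poly_Mapping.keys g \<subseteq> B"
  shows "f \<star>\<^bsub>q\<^esub> g =
    (\<Sum>u\<in>A. \<Sum>v\<in>B. (Poly_Mapping.lookup f u * Poly_Mapping.lookup g v) \<odot> word_qshuffle q u v)"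
proof -
  let ?t = "\<lambda>u v. (Poly_Mapping.lookup f u * Poly_Mapping.lookup g v) \<odot> word_qshuffle q u v"
  have "(\<Sum>v\<in>Poly_Mapping.keys g. ?t u v) = (\<Sum>v\<in>B. ?t u v)" for u
    by (rule sum.mono_neutral_left) (use assms in \<open>auto simp: in_keys_iff\<close>)
  then have "f \<star>\<^bsub>q\<^esub> g = (\<Sum>u\<in>Poly_Mapping.keys f. \<Sum>v\<in>B. ?t u v)"
    by (simp add: qshuffle_def)
  also have "\<dots> = (\<Sum>u\<in>A. \<Sum>v\<in>B. ?t u v)"
    by (rule sum.mono_neutral_left) (use assms in \<open>auto simp: in_keys_iff\<close>)
  finally show ?thesis .
qed

lemma qshuffle_1_left: "1 \<star>\<^bsub>q\<^esub> f = f"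
proof -
  have "of_word [] \<star>\<^bsub>q\<^esub> f = f"
    using of_word_expand[of f] by (simp add: qshuffle_def of_word_def[of "[]"])
  then show ?thesis by (simp add: of_word_Nil)
qed

lemma qshuffle_1_right: "f \<star>\<^bsub>q\<^esub> 1 = f"
proof -
  have "f \<star>\<^bsub>q\<^esub> of_word [] = f"
    using of_word_expand[of f]
    by (simp add: qshuffle_def of_word_def[of "[]"] word_qshuffle_Nil_right)
  then show ?thesis by (simp add: of_word_Nil)
qed

lemma qshuffle_add_left: "(f + g) \<star>\<^bsub>q\<^esub> h = f \<star>\<^bsub>q\<^esub> h + g \<star>\<^bsub>q\<^esub> h"
proof -
  let ?A = "Poly_Mapping.keys f \<union> Poly_Mapping.keys g"
  have "Poly_Mapping.keys (f + g) \<subseteq> ?A"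
    by (rule Poly_Mapping.keys_add)
  then show ?thesis
    by (simp add: qshuffle_superset[where A = ?A and B = "Poly_Mapping.keys h"]
        lookup_add distrib_right scal_add_left sum.distrib)
qed

lemma qshuffle_add_right: "h \<star>\<^bsub>q\<^esub> (f + g) = h \<star>\<^bsub>q\<^esub> f + h \<star>\<^bsub>q\<^esub> g"
proof -
  let ?B = "Poly_Mapping.keys f \<union> Poly_Mapping.keys g"
  have "Poly_Mapping.keys (f + g) \<subseteq> ?B"
    by (rule Poly_Mapping.keys_add)
  then show ?thesis
    by (simp add: qshuffle_superset[where B = ?B and A = "Poly_Mapping.keys h"]
        lookup_add distrib_left scal_add_left sum.distrib)
qed

lemma keys_scal: "Poly_Mapping.keys (c \<odot> f) \<subseteq> Poly_Mapping.keys f"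
  by (auto simp: in_keys_iff)

lemma qshuffle_scal_left: "(c \<odot> f) \<star>\<^bsub>q\<^esub> g = c \<odot> (f \<star>\<^bsub>q\<^esub> g)"
  by (simp add: qshuffle_superset[where A = "Poly_Mapping.keys f" and B = "Poly_Mapping.keys g"]
      keys_scal scal_sum scal_scal mult.assoc)

lemma qshuffle_scal_right: "f \<star>\<^bsub>q\<^esub> (c \<odot> g) = c \<odot> (f \<star>\<^bsub>q\<^esub> g)"
  by (simp add: qshuffle_superset[where A = "Poly_Mapping.keys f" and B = "Poly_Mapping.keys g"]
      keys_scal scal_sum scal_scal mult.left_commute)

end

theory Submission
  imports Defs
begin

text \<open>
  Stripping the first letter of either factor of an alternating-word product leaves a product of
  two alternating words.  Let $a \neq b$ be the letters and let $P(l,m)$ be the shuffle product of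
  the alternating words of lengths $l$ and $m$ that end in $a$ and in $b$.  The four alternating
  sums of $P(l,m)$ with fixed $l+m$ and fixed parities of $l$ and $m$ satisfy a closed linear
  recursion.  The sums with $l+m$ odd then satisfy $T_a(N+1) = (1+q^2)\, aa\, T_b(N)$ and
  $T_b(N+1) = -(1+q^{-2})\, bb\, T_a(N)$, where the index $a$ or $b$ is the last letter of the
  factor of odd length, and the sum of the $P(l,m)$ with both lengths odd is
  $a\, T_b + q^{-2}\, b\, T_a$.  The first and third identities are the case $a = y$, $b = x$,
  the other two the case $a = x$, $b = y$.
\<close>

section \<open>Scalars in the free algebra\<close>

lemma of_word_mult_scal: "of_word w * (c \<odot> f) = c \<odot> (of_word w * f)"
proof -
  have scal_single: "d \<odot> Poly_Mapping.single u e = Poly_Mapping.single u (d * e)"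
    for d e :: 'a and u
    by (rule poly_mapping_eqI) (simp add: lookup_single when_def)
  \<comment> \<open>Both sides are additive in the algebra element, so it suffices to treat a
    multiple of a single word.\<close>
  have single: "of_word w * (c \<odot> d \<odot> of_word u) = c \<odot> (of_word w * (d \<odot> of_word u))" for d u
    by (simp add: of_word_def mult_single scal_single)
  show ?thesis
    by (subst (1 2) of_word_expand[of f]) (simp only: scal_sum sum_distrib_left single)
qed

lemma scal_minus_left: "(- c) \<odot> f = - (c \<odot> f)"
  by (rule poly_mapping_eqI) simp

lemma scal_diff_right: "c \<odot> (f - g) = c \<odot> f - c \<odot> g"
  by (rule poly_mapping_eqI) (simp add: lookup_minus algebra_simps)

lemma of_word_mult_signed_sum:
  "of_word w * (\<Sum>k\<in>A. c k \<odot> f k) = (\<Sum>k\<in>A. c k \<odot> (of_word w * f k))"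
  by (simp add: sum_distrib_left of_word_mult_scal)

section \<open>Alternating words and the shuffle of two of them\<close>

text \<open>The word of length $l$ that ends in $a$; it starts with $a$ exactly if $l$ is odd.\<close>

fun alternating :: "letter \<Rightarrow> letter \<Rightarrow> nat \<Rightarrow> word" where
  "alternating a b 0 = []"
| "alternating a b (Suc l) = (if even l then a else b) # alternating a b l"

text \<open>Adjacent letters have opposite pairings with any \<open>c\<close> and cancel in pairs;
  in odd length one \<open>a\<close> remains. Hence the powers of \<open>q\<close> in the shuffle
  depend only on parities.\<close>

lemma sum_pairing_alternating:
  assumes "a \<noteq> b"
  shows "(\<Sum>d\<leftarrow>alternating a b l. pairing c d) = (if odd l then pairing c a else 0)"
proof -
  have "pairing c a + pairing c b = 0"
    using assms by (cases a; cases b; cases c) (simp_all add: pairing_def)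
  then show ?thesis
    by (induction l) auto
qed

lemma of_word_alternating_odd:
  "of_word (alternating a b (2 * n + 1)) = (of_word [a] * of_word [b]) ^ n * of_word [a]"
proof (induction n)
  case (Suc n)
  have "alternating a b (2 * Suc n + 1) = [a] @ [b] @ alternating a b (2 * n + 1)"
    by simp
  then show ?case
    using Suc by (simp only: of_word_append power_Suc mult.assoc)
qed simp

text \<open>This is P(l,m) of the overview; the swapped letters make the second factor end in
  \<open>b\<close>.\<close>

definition alt_shuffle :: "'a::field \<Rightarrow> letter \<Rightarrow> letter \<Rightarrow> nat \<Rightarrow> nat \<Rightarrow> 'a freealg" where
  "alt_shuffle q a b l m = word_qshuffle q (alternating a b l) (alternating b a m)"

lemma alt_shuffle_Suc_Suc:
  assumes "a \<noteq> b"
  shows "alt_shuffle q a b (Suc l) (Suc m) =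
    of_word [if even l then a else b] * alt_shuffle q a b l (Suc m)
    + q powi (if odd l then 0 else if even m then - 2 else 2) \<odot>
        (of_word [if even m then b else a] * alt_shuffle q a b (Suc l) m)"
proof -
  have "(\<Sum>d\<leftarrow>alternating a b (Suc l). pairing (if even m then b else a) d)
      = (if odd l then 0 else if even m then - 2 else 2)"
    using assms by (simp only: sum_pairing_alternating[OF assms]) (simp add: pairing_def)
  then show ?thesis
    by (simp add: alt_shuffle_def)
qed

lemma alt_shuffle_0_Suc:
  "alt_shuffle q a b 0 (Suc m) = of_word [if even m then b else a] * alt_shuffle q a b 0 m"
  by (simp add: alt_shuffle_def flip: of_word_append)

lemma alt_shuffle_Suc_0:
  "alt_shuffle q a b (Suc l) 0 = of_word [if even l then a else b] * alt_shuffle q a b l 0"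
  by (simp add: alt_shuffle_def word_qshuffle_Nil_right flip: of_word_append)

section \<open>Signed sums over products of fixed total length\<close>

definition alt_sum :: "'a::field \<Rightarrow> letter \<Rightarrow> letter \<Rightarrow> nat \<Rightarrow> nat \<Rightarrow> nat \<Rightarrow> 'a freealg" where
  "alt_sum q a b i j N = (\<Sum>k\<le>N. (-1) ^ k \<odot> alt_shuffle q a b (2 * k + i) (2 * (N - k) + j))"

text \<open>Neither factor is ever empty, so the shuffle recursion applies to every summand with no
  boundary term.\<close>

lemma alt_sum_odd_odd:
  assumes "a \<noteq> b"
  shows "alt_sum q a b 1 1 N
    = of_word [a] * alt_sum q a b 0 1 N + q powi (-2) \<odot> (of_word [b] * alt_sum q a b 1 0 N)"
  by (simp add: alt_sum_def alt_shuffle_Suc_Suc[OF assms] of_word_mult_signed_sum scal_sum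
      scal_add_right scal_scal sum.distrib mult.commute)

text \<open>Left factors start with \<open>b\<close> and right factors with \<open>a\<close>.
  Passing an even left factor costs no power of \<open>q\<close>; the minus sign comes from the
  index shift when the left factor is shortened.\<close>

lemma alt_sum_even_even:
  assumes "a \<noteq> b"
  shows "alt_sum q a b 0 0 (Suc N)
    = of_word [a] * alt_sum q a b 0 1 N - of_word [b] * alt_sum q a b 1 0 N"
proof -
  let ?P = "alt_shuffle q a b"
  \<comment> \<open>At \<open>k = 0\<close> the left factor is empty and at \<open>k = Suc N\<close>
    the right one, so one of the two terms is missing.\<close>
  have split: "?P (2 * k) (2 * (Suc N - k))
      = (if k = 0 then 0 else of_word [b] * ?P (2 * (k - 1) + 1) (2 * (Suc N - k)))
      + (if k = Suc N then 0 else of_word [a] * ?P (2 * k) (2 * (N - k) + 1))"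
    if "k \<le> Suc N" for k
  proof (cases k)
    case 0
    then show ?thesis
      using alt_shuffle_0_Suc[of q a b "2 * N + 1"] by simp
  next
    case k: (Suc k')
    show ?thesis
    proof (cases "k = Suc N")
      case True
      then show ?thesis
        using alt_shuffle_Suc_0[of q a b "2 * N + 1"] by simp
    next
      case False
      then have "Suc N - k = Suc (N - k)"
        using that by simp
      then show ?thesis
        using False k alt_shuffle_Suc_Suc[OF assms, of q "2 * k' + 1" "2 * (N - k) + 1"] by simp
    qed
  qed
  have "alt_sum q a b 0 0 (Suc N)
      = (\<Sum>k\<le>Suc N. if k = 0 then 0
          else (-1) ^ k \<odot> (of_word [b] * ?P (2 * (k - 1) + 1) (2 * (Suc N - k))))
      + (\<Sum>k\<le>Suc N. if k = Suc N then 0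
          else (-1) ^ k \<odot> (of_word [a] * ?P (2 * k) (2 * (N - k) + 1)))"
    unfolding alt_sum_def sum.distrib[symmetric]
    by (rule sum.cong) (auto simp: split scal_add_right)
  also have "(\<Sum>k\<le>Suc N. if k = 0 then 0
          else (-1) ^ k \<odot> (of_word [b] * ?P (2 * (k - 1) + 1) (2 * (Suc N - k))))
      = - (of_word [b] * alt_sum q a b 1 0 N)"
    \<comment> \<open>The zero term at \<open>k = 0\<close> drops out, and replacing
      \<open>k\<close> by \<open>Suc k\<close> flips every sign.\<close>
    by (subst sum.atMost_Suc_shift)
      (simp add: alt_sum_def of_word_mult_signed_sum scal_minus_left sum_negf)
  also have "(\<Sum>k\<le>Suc N. if k = Suc N then 0
          else (-1) ^ k \<odot> (of_word [a] * ?P (2 * k) (2 * (N - k) + 1)))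
      = of_word [a] * alt_sum q a b 0 1 N"
    by (simp add: alt_sum_def of_word_mult_signed_sum)
  finally show ?thesis
    by simp
qed

text \<open>Both factors start with \<open>a\<close>, which can therefore be pulled out. Moving the
  right \<open>a\<close> past a left factor of odd length costs q^2; only the right factor can be
  empty, so no index is shifted.\<close>

lemma alt_sum_odd_even:
  assumes "a \<noteq> b"
  shows "alt_sum q a b 1 0 (Suc N)
    = of_word [a] * (alt_sum q a b 0 0 (Suc N) + q powi 2 \<odot> alt_sum q a b 1 1 N)"
proof -
  let ?P = "alt_shuffle q a b"
  have split: "?P (2 * k + 1) (2 * (Suc N - k))
      = of_word [a] * ?P (2 * k) (2 * (Suc N - k))
      + (if k = Suc N then 0 else q powi 2 \<odot> (of_word [a] * ?P (2 * k + 1) (2 * (N - k) + 1)))"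
    if "k \<le> Suc N" for k
  proof (cases "k = Suc N")
    case True
    then show ?thesis
      using alt_shuffle_Suc_0[of q a b "2 * k"] by simp
  next
    case False
    then have "Suc N - k = Suc (N - k)"
      using that by simp
    then show ?thesis
      using False alt_shuffle_Suc_Suc[OF assms, of q "2 * k" "2 * (N - k) + 1"] by simp
  qed
  have "alt_sum q a b 1 0 (Suc N)
      = (\<Sum>k\<le>Suc N. (-1) ^ k \<odot> (of_word [a] * ?P (2 * k) (2 * (Suc N - k))))
      + (\<Sum>k\<le>Suc N. if k = Suc N then 0
          else (-1) ^ k \<odot> q powi 2 \<odot> (of_word [a] * ?P (2 * k + 1) (2 * (N - k) + 1)))"
    unfolding alt_sum_def sum.distrib[symmetric]
    by (rule sum.cong) (auto simp: split[simplified] scal_add_right)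
  also have "(\<Sum>k\<le>Suc N. (-1) ^ k \<odot> (of_word [a] * ?P (2 * k) (2 * (Suc N - k))))
      = of_word [a] * alt_sum q a b 0 0 (Suc N)"
    unfolding alt_sum_def of_word_mult_signed_sum by simp
  also have "(\<Sum>k\<le>Suc N. if k = Suc N then 0
          else (-1) ^ k \<odot> q powi 2 \<odot> (of_word [a] * ?P (2 * k + 1) (2 * (N - k) + 1)))
      = of_word [a] * (q powi 2 \<odot> alt_sum q a b 1 1 N)"
    by (simp add: alt_sum_def of_word_mult_signed_sum of_word_mult_scal scal_sum scal_scal
        mult.commute)
  finally show ?thesis
    by (simp only: distrib_left)
qed

text \<open>Here both factors start with \<open>b\<close>, the left factor has even length and so
  gives no power of \<open>q\<close>, and shortening it shifts the index and changes the
  sign.\<close>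

lemma alt_sum_even_odd:
  assumes "a \<noteq> b"
  shows "alt_sum q a b 0 1 (Suc N)
    = of_word [b] * (alt_sum q a b 0 0 (Suc N) - alt_sum q a b 1 1 N)"
proof -
  let ?P = "alt_shuffle q a b"
  \<comment> \<open>No bound on \<open>k\<close> is imposed: the right length is a successor even
    where the subtraction truncates to 0.\<close>
  have split: "?P (2 * k) (2 * (Suc N - k) + 1)
      = (if k = 0 then 0 else of_word [b] * ?P (2 * (k - 1) + 1) (2 * (Suc N - k) + 1))
      + of_word [b] * ?P (2 * k) (2 * (Suc N - k))" for k
  proof (cases k)
    case 0
    then show ?thesis
      using alt_shuffle_0_Suc[of q a b "2 * Suc N"] by simp
  next
    case (Suc k')
    then show ?thesis
      using alt_shuffle_Suc_Suc[OF assms, of q "2 * k' + 1" "2 * (Suc N - k)"] by simp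
  qed
  have "alt_sum q a b 0 1 (Suc N)
      = (\<Sum>k\<le>Suc N. if k = 0 then 0
          else (-1) ^ k \<odot> (of_word [b] * ?P (2 * (k - 1) + 1) (2 * (Suc N - k) + 1)))
      + (\<Sum>k\<le>Suc N. (-1) ^ k \<odot> (of_word [b] * ?P (2 * k) (2 * (Suc N - k))))"
    unfolding alt_sum_def sum.distrib[symmetric]
    by (rule sum.cong) (auto simp: split[simplified] scal_add_right)
  also have "(\<Sum>k\<le>Suc N. if k = 0 then 0
          else (-1) ^ k \<odot> (of_word [b] * ?P (2 * (k - 1) + 1) (2 * (Suc N - k) + 1)))
      = - (of_word [b] * alt_sum q a b 1 1 N)"
    by (subst sum.atMost_Suc_shift)
      (simp add: alt_sum_def of_word_mult_signed_sum scal_minus_left sum_negf)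
  also have "(\<Sum>k\<le>Suc N. (-1) ^ k \<odot> (of_word [b] * ?P (2 * k) (2 * (Suc N - k))))
      = of_word [b] * alt_sum q a b 0 0 (Suc N)"
    unfolding alt_sum_def of_word_mult_signed_sum by simp
  finally show ?thesis
    by (simp add: right_diff_distrib)
qed

section \<open>Two-term recursion and closed forms\<close>

text \<open>In the even-even sum plus q^2 times the odd-odd sum, the terms starting with
  \<open>b\<close> have coefficients -1 and q^2 q^(-2) = 1 and cancel.\<close>

lemma alt_sum_odd_even_rec:
  assumes "a \<noteq> b" and "q \<noteq> 0"
  shows "alt_sum q a b 1 0 (Suc N)
    = (1 + q powi 2) \<odot> (of_word [a] * (of_word [a] * alt_sum q a b 0 1 N))"
proof -
  have "q powi 2 * q powi (-2) = 1"
    using assms by (simp add: power_int_minus)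
  then show ?thesis
    unfolding alt_sum_odd_even[OF assms(1)] alt_sum_even_even[OF assms(1)]
      alt_sum_odd_odd[OF assms(1)]
    by (simp add: scal_add_right scal_add_left scal_scal distrib_left of_word_mult_scal)
qed

text \<open>In the even-even sum minus the odd-odd sum it is the terms starting with
  \<open>a\<close> that cancel.\<close>

lemma alt_sum_even_odd_rec:
  assumes "a \<noteq> b"
  shows "alt_sum q a b 0 1 (Suc N)
    = (- (1 + q powi (-2))) \<odot> (of_word [b] * (of_word [b] * alt_sum q a b 1 0 N))"
  unfolding alt_sum_even_odd[OF assms] alt_sum_even_even[OF assms] alt_sum_odd_odd[OF assms]
    scal_minus_left
  by (simp add: scal_add_left algebra_simps of_word_mult_scal)

lemma qtwo_squared:
  assumes "q \<noteq> 0"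
  shows "(1 + q powi 2) * (1 + q powi (-2)) = qtwo q ^ 2"
  using assms by (simp add: qtwo_def power_int_minus field_simps power2_eq_square)

text \<open>Applying both recursions returns to the same sum with index lowered by 2, a factor
  -[2]_q^2 and the prefix aabb or bbaa. At index 0 the sums are the single letters.\<close>

lemma alt_sum_closed:
  fixes q :: "'a::field" and a b :: letter
  assumes "a \<noteq> b" and "q \<noteq> 0"
  defines "A \<equiv> of_word [a]" and "B \<equiv> of_word [b]"
  shows "alt_sum q a b 1 0 (2 * n) = ((-1) ^ n * qtwo q ^ (2 * n)) \<odot> ((A * A * B * B) ^ n * A)"
    and "alt_sum q a b 0 1 (2 * n) = ((-1) ^ n * qtwo q ^ (2 * n)) \<odot> ((B * B * A * A) ^ n * B)"
proof (induction n)
  case 0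
  show "alt_sum q a b 1 0 (2 * 0) = ((-1) ^ 0 * qtwo q ^ (2 * 0)) \<odot> ((A * A * B * B) ^ 0 * A)"
    and "alt_sum q a b 0 1 (2 * 0) = ((-1) ^ 0 * qtwo q ^ (2 * 0)) \<odot> ((B * B * A * A) ^ 0 * B)"
    by (simp_all add: alt_sum_def alt_shuffle_def A_def B_def)
next
  case (Suc n)
  define c where "c = (-1) ^ n * qtwo q ^ (2 * n)"
  \<comment> \<open>The same scalar is factored in the two orders in which the recursions produce
    it.\<close>
  have coeff: "(-1) ^ Suc n * qtwo q ^ (2 * Suc n) = (1 + q powi 2) * (- (1 + q powi (-2)) * c)"
    "(-1) ^ Suc n * qtwo q ^ (2 * Suc n) = - (1 + q powi (-2)) * ((1 + q powi 2) * c)"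
  proof -
    have "(-1) ^ Suc n * qtwo q ^ (2 * Suc n) = - (qtwo q ^ 2 * c)"
      by (simp add: c_def power2_eq_square)
    then show "(-1) ^ Suc n * qtwo q ^ (2 * Suc n) = (1 + q powi 2) * (- (1 + q powi (-2)) * c)"
      and "(-1) ^ Suc n * qtwo q ^ (2 * Suc n) = - (1 + q powi (-2)) * ((1 + q powi 2) * c)"
      unfolding qtwo_squared[OF assms(2), symmetric]
      by (simp_all only: ac_simps mult_minus_left mult_minus_right)
  qed
  have step: "2 * Suc n = Suc (Suc (2 * n))"
    by simp
  note IH = Suc.IH[folded c_def]
  show "alt_sum q a b 1 0 (2 * Suc n)
      = ((-1) ^ Suc n * qtwo q ^ (2 * Suc n)) \<odot> ((A * A * B * B) ^ Suc n * A)"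
    unfolding coeff(1) unfolding step alt_sum_odd_even_rec[OF assms(1,2)]
      alt_sum_even_odd_rec[OF assms(1)] IH
    by (simp only: of_word_mult_scal scal_scal A_def B_def mult.assoc power_Suc)
  show "alt_sum q a b 0 1 (2 * Suc n)
      = ((-1) ^ Suc n * qtwo q ^ (2 * Suc n)) \<odot> ((B * B * A * A) ^ Suc n * B)"
    unfolding coeff(2) unfolding step alt_sum_odd_even_rec[OF assms(1,2)]
      alt_sum_even_odd_rec[OF assms(1)] IH
    by (simp only: of_word_mult_scal scal_scal A_def B_def mult.assoc power_Suc)
qed

lemma alt_sum_odd_odd_closed:
  fixes q :: "'a::field" and a b :: letter
  assumes "a \<noteq> b" and "q \<noteq> 0"
  defines "A \<equiv> of_word [a]" and "B \<equiv> of_word [b]"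
  shows "alt_sum q a b 1 1 (2 * n) = ((-1) ^ n * qtwo q ^ (2 * n)) \<odot>
      (q powi (-2) \<odot> (B * (A * A * B * B) ^ n * A) + A * (B * B * A * A) ^ n * B)"
    and "alt_sum q a b 1 1 (2 * n + 1) = ((-1) ^ n * q powi (-1) * qtwo q ^ (2 * n + 1)) \<odot>
      (B * A * A * (B * B * A * A) ^ n * B - A * B * B * (A * A * B * B) ^ n * A)"
proof -
  note closed = alt_sum_closed[OF assms(1,2), folded A_def B_def, of n]
  show "alt_sum q a b 1 1 (2 * n) = ((-1) ^ n * qtwo q ^ (2 * n)) \<odot>
      (q powi (-2) \<odot> (B * (A * A * B * B) ^ n * A) + A * (B * B * A * A) ^ n * B)"
    unfolding alt_sum_odd_odd[OF assms(1)] closed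
    by (simp add: of_word_mult_scal scal_scal scal_add_right A_def B_def mult.assoc mult_ac(3)
        add.commute mult.commute)
  define c where "c = (-1) ^ n * qtwo q ^ (2 * n)"
  \<comment> \<open>For odd index one more recursion step is taken. Both words then get the
    coefficient 1 + q^(-2) = q^(-1) [2]_q up to sign, since q^(-2) (1 + q^2) = 1 + q^(-2).\<close>
  have coeff: "(-1) ^ n * q powi (-1) * qtwo q ^ (2 * n + 1) = (1 + q powi (-2)) * c"
    "q powi (-2) * ((1 + q powi 2) * c) = (1 + q powi (-2)) * c"
    using assms(2) by (simp_all add: c_def qtwo_def power_int_minus field_simps power2_eq_square)
  have "alt_sum q a b 1 1 (2 * n + 1)
      = ((1 + q powi (-2)) * c) \<odot> (B * A * A * (B * B * A * A) ^ n * B)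
        - ((1 + q powi (-2)) * c) \<odot> (A * B * B * (A * A * B * B) ^ n * A)"
    unfolding alt_sum_odd_odd[OF assms(1)] Suc_eq_plus1[symmetric] alt_sum_odd_even_rec[OF assms(1,2)]
      alt_sum_even_odd_rec[OF assms(1)] closed[folded c_def]
    by (simp only: A_def B_def of_word_mult_scal scal_scal coeff(2) scal_minus_left mult.assoc
        mult_minus_left mult_minus_right) simp
  then show "alt_sum q a b 1 1 (2 * n + 1) = ((-1) ^ n * q powi (-1) * qtwo q ^ (2 * n + 1)) \<odot>
      (B * A * A * (B * B * A * A) ^ n * B - A * B * B * (A * A * B * B) ^ n * A)"
    by (simp only: coeff(1) scal_diff_right)
qed

section \<open>Translation to the words W_m\<close>

theorem proposition5p10:
  fixes q :: "'a::field_char_0" and n :: nat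
  assumes "q \<noteq> 0"
    and "\<And>m::nat. m > 0 \<Longrightarrow> q ^ m \<noteq> 1"
  shows
   "(\<Sum>k = 0..2 * n. (-1) ^ k \<odot> (alt_word (int k + 1) \<star>\<^bsub>q\<^esub> alt_word (int k - 2 * int n)))
      = ((-1) ^ n * qtwo q ^ (2 * n)) \<odot>
          (q powi (-2) \<odot> (\<^bold>x * (\<^bold>y * \<^bold>y * \<^bold>x * \<^bold>x) ^ n * \<^bold>y) + \<^bold>y * (\<^bold>x * \<^bold>x * \<^bold>y * \<^bold>y) ^ n * \<^bold>x)
    \<and> (\<Sum>k = 0..2 * n. (-1) ^ k \<odot> (alt_word (int k - 2 * int n) \<star>\<^bsub>q\<^esub> alt_word (int k + 1)))
      = ((-1) ^ n * qtwo q ^ (2 * n)) \<odot>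
          (\<^bold>x * (\<^bold>y * \<^bold>y * \<^bold>x * \<^bold>x) ^ n * \<^bold>y + q powi (-2) \<odot> (\<^bold>y * (\<^bold>x * \<^bold>x * \<^bold>y * \<^bold>y) ^ n * \<^bold>x))
    \<and> (\<Sum>k = 0..2 * n + 1. (-1) ^ k \<odot> (alt_word (int k + 1) \<star>\<^bsub>q\<^esub> alt_word (int k - 2 * int n - 1)))
      = ((-1) ^ n * q powi (-1) * qtwo q ^ (2 * n + 1)) \<odot>
          (\<^bold>x * \<^bold>y * \<^bold>y * (\<^bold>x * \<^bold>x * \<^bold>y * \<^bold>y) ^ n * \<^bold>x - \<^bold>y * \<^bold>x * \<^bold>x * (\<^bold>y * \<^bold>y * \<^bold>x * \<^bold>x) ^ n * \<^bold>y)
    \<and> (\<Sum>k = 0..2 * n + 1. (-1) ^ k \<odot> (alt_word (int k - 2 * int n - 1) \<star>\<^bsub>q\<^esub> alt_word (int k + 1)))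
      = ((-1) ^ n * q powi (-1) * qtwo q ^ (2 * n + 1)) \<odot>
          (\<^bold>x * \<^bold>y * \<^bold>y * (\<^bold>x * \<^bold>x * \<^bold>y * \<^bold>y) ^ n * \<^bold>x - \<^bold>y * \<^bold>x * \<^bold>x * (\<^bold>y * \<^bold>y * \<^bold>x * \<^bold>x) ^ n * \<^bold>y)"
proof -
  have pos: "alt_word (int k + 1) = (of_word (alternating LY LX (2 * k + 1)) :: 'a freealg)" for k
    by (simp only: of_word_alternating_odd alt_word_pos)
  have nonpos: "alt_word (int k - int N)
      = (of_word (alternating LX LY (2 * (N - k) + 1)) :: 'a freealg)" if "k \<le> N" for k N
    using that alt_word_nonpos[of "N - k"] by (simp only: of_word_alternating_odd of_nat_diff) simp
  \<comment> \<open>The factors have lengths 2k+1 and 2(N-k)+1, so this is an odd-odd sum;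
    \<open>N\<close> will be 2n or 2n+1.\<close>
  have left: "(\<Sum>k = 0..N. (-1) ^ k \<odot> (alt_word (int k + 1) \<star>\<^bsub>q\<^esub> alt_word (int k - int N)))
      = alt_sum q LY LX 1 1 N" for N
    unfolding alt_sum_def alt_shuffle_def
    by (rule sum.cong) (auto simp only: pos nonpos qshuffle_of_word atLeast0AtMost atMost_iff)
  have "(\<Sum>k = 0..N. (-1) ^ k \<odot> (alt_word (int k - int N) \<star>\<^bsub>q\<^esub> alt_word (int k + 1)))
      = (\<Sum>k\<le>N. (-1) ^ k \<odot> alt_shuffle q LX LY (2 * (N - k) + 1) (2 * k + 1))" for N
    unfolding alt_shuffle_def
    by (rule sum.cong) (auto simp only: pos nonpos qshuffle_of_word atLeast0AtMost atMost_iff)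
  \<comment> \<open>In the reversed order the left factor shrinks as \<open>k\<close> grows.
    Reversing the summation gives the sign (-1)^N, which for odd \<open>N\<close> compensates the
    exchange of x and y in the antisymmetric right-hand side.\<close>
  moreover have "(\<Sum>k\<le>N. (-1) ^ k \<odot> alt_shuffle q LX LY (2 * (N - k) + 1) (2 * k + 1))
      = (-1) ^ N \<odot> alt_sum q LX LY 1 1 N" for N
  proof -
    have "(-1) ^ N * (-1) ^ k = ((-1) ^ (N - k) :: 'a)" if "k \<le> N" for k
      using that by (simp add: minus_one_power_iff)
    then have "(-1) ^ N \<odot> alt_sum q LX LY 1 1 N
        = (\<Sum>k\<le>N. (-1) ^ (N - k) \<odot> alt_shuffle q LX LY (2 * k + 1) (2 * (N - k) + 1))"
      by (simp add: alt_sum_def scal_sum scal_scal)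
    also have "\<dots> = (\<Sum>k\<le>N. (-1) ^ k \<odot> alt_shuffle q LX LY (2 * (N - k) + 1) (2 * k + 1))"
      by (rule sum.reindex_bij_witness[where i = "\<lambda>k. N - k" and j = "\<lambda>k. N - k"]) auto
    finally show ?thesis
      by simp
  qed
  ultimately have right:
    "(\<Sum>k = 0..N. (-1) ^ k \<odot> (alt_word (int k - int N) \<star>\<^bsub>q\<^esub> alt_word (int k + 1)))
      = (-1) ^ N \<odot> alt_sum q LX LY 1 1 N" for N
    by simp
  have index: "2 * int n = int (2 * n)" "int k - int (2 * n) - 1 = int k - int (2 * n + 1)" for k
    by simp_all
  note closed = alt_sum_odd_odd_closed[OF _ assms(1)]
  show ?thesis
    unfolding index left right
    by (simp add: closed[simplified] scal_minus_left scal_diff_right add.commute)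
qed

end
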